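(* Let $e(n,k)$ denote the expected number of integer times $j\in\{1,\dots,\lfloor k\rfloor\}$ at which the $n$-detachment process is in a state of detachment. For $y>0$ put $k(n,y):=\dfrac{n^2}{2(2\log n-2\log\log n+y)}$. Expanding $k(n,y)$ as $n\to\infty$, $$k(n,y)=\frac{n^2}{4\log n}+\frac{n^2\log\log n}{4(\log n)^2}-\frac{n^2y}{8(\log n)^2}+\mathcal{O}\!\left(\frac{n^2(\log\log n)^2}{(\log n)^3}\right)=\frac{n^2}{4\log n}\left\{1+\frac{\log\log n-y/2}{\log n}+\mathcal{O}\!\left(\left[\frac{\log\log n}{\log n}\right]^2\right)\right\},$$ one concludes that for $c>1/8$ and $$k(n,c):=\frac{n^2}{4\log n}\left\{1+\frac{\log\log n+\log\sqrt{8c}}{\log n}+\mathcal{O}\!\left(\left[\frac{\log\log n}{\log n}\right]^2\right)\right\}$$ the relation $\lim_{n\to\infty}e(n,k(n,c))=c$ holds; that is, one needs $k(n,c)$ amount of time to have $c$ detachment events (times in a state of detachment) on average with $n\gg1$ passengers. Loosely speaking, with constants $0<\mathrm{const}_1<\mathrm{const}_2$, the critical time window is about $$\left[\frac{n^2}{4\log n}\left\{1+\frac{\log\log n+\mathrm{const}_1}{\log n}\right\},\ \frac{n^2}{4\log n}\left\{1+\frac{\log\log n+\mathrm{const}_2}{\log n}\right\}\right]$$ for large $n$, and the expected number of times in a state of detachment there is about $\frac18\left(\exp(2\,\mathrm{const}_2)-\exp(2\,\mathrm{const}_1)\right)$. The size of the window around $n^2/(4\log n)$ is $\sim\mathrm{const}\cdot\left(\dfrac{n}{\log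 n}\right)^2$.
   Context: The $n$-detachment process ($n\ge1$): there are $n$ labeled passengers. At time $1$ all passengers sit in bus number $1$. At each integer time $k\ge 2$, a new bus with number $k$ becomes available and each passenger (currently sitting in one of the buses $1,\dots,k-1$), independently of the others and of the past, relocates to bus $k$ with probability $1/k$ and otherwise stays where they are. A passenger is lonely at time $k$ if no other passenger is in the same bus at time $k$; $L_k$ denotes the number of lonely passengers at time $k$. The process is in a state of detachment at time $k$ if $L_k=n$. Thus $e(n,k)=\sum_{j=1}^{\lfloor k\rfloor}P^{(n)}(L_j=n)$, where $P^{(n)}$ is the law with $n$ passengers. $\log$ is the natural logarithm, and $a_n\sim b_n$ means $a_n/b_n\to1$. *)

theory Defs
  imports "HOL-Probability.Probability" "HOL-Library.Landau_Symbols"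
begin

text \<open>
  The coin of index \<open>(i, k)\<close> decides whether passenger \<open>i < n\<close> relocates to bus \<open>k\<close> at time
  \<open>k \<ge> 2\<close>. All coins are independent and the coin \<open>(i, k)\<close> succeeds with probability \<open>1/k\<close>;
  the \<open>n\<close>-detachment process is a deterministic function of them.
\<close>

definition relocation_coins :: "nat \<Rightarrow> (nat \<times> nat \<Rightarrow> bool) measure" where
  "relocation_coins n =
     PiM ({..<n} \<times> {2..}) (\<lambda>(i, k). measure_pmf (bernoulli_pmf (1 / real k)))"

text \<open>The process starts at time 1; the value at time 0 is a dummy.\<close>

primrec bus :: "(nat \<times> nat \<Rightarrow> bool) \<Rightarrow> nat \<Rightarrow> nat \<Rightarrow> nat" where
  "bus \<omega> i 0 = 1"
| "bus \<omega> i (Suc k) = (if Suc k \<ge> 2 \<and> \<omega> (i, Suc k) then Suc k else bus \<omega> i k)"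

definition lonely :: "nat \<Rightarrow> (nat \<times> nat \<Rightarrow> bool) \<Rightarrow> nat \<Rightarrow> nat \<Rightarrow> bool" where
  "lonely n \<omega> k i \<longleftrightarrow> (\<forall>j<n. j \<noteq> i \<longrightarrow> bus \<omega> j k \<noteq> bus \<omega> i k)"

definition num_lonely :: "nat \<Rightarrow> (nat \<times> nat \<Rightarrow> bool) \<Rightarrow> nat \<Rightarrow> nat" where
  "num_lonely n \<omega> k = card {i. i < n \<and> lonely n \<omega> k i}"

definition detached :: "nat \<Rightarrow> (nat \<times> nat \<Rightarrow> bool) \<Rightarrow> nat \<Rightarrow> bool" where
  "detached n \<omega> k \<longleftrightarrow> num_lonely n \<omega> k = n"

definition expected_detachments :: "nat \<Rightarrow> nat set \<Rightarrow> real" where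
  "expected_detachments n J =
     integral\<^sup>L (relocation_coins n) (\<lambda>\<omega>. real (card {j \<in> J. detached n \<omega> j}))"

definition e :: "nat \<Rightarrow> real \<Rightarrow> real" where
  "e n k = expected_detachments n {1..nat \<lfloor>k\<rfloor>}"

definition k_of_y :: "real \<Rightarrow> nat \<Rightarrow> real" where
  "k_of_y y n = (real n)\<^sup>2 / (2 * (2 * ln (real n) - 2 * ln (ln (real n)) + y))"

text \<open>
  \<open>critical_expansion a k\<close> says that, as \<open>n \<rightarrow> \<infinity>\<close>,
  \<open>k n = n\<^sup>2 / (4 log n) {1 + (log log n + a) / log n + O([log log n / log n]\<^sup>2)}\<close>.
\<close>

definition critical_expansion :: "real \<Rightarrow> (nat \<Rightarrow> real) \<Rightarrow> bool" where
  "critical_expansion a k \<longleftrightarrow>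
     (\<exists>r \<in> O(\<lambda>n. (ln (ln (real n)) / ln (real n))\<^sup>2).
        \<forall>\<^sub>F n in sequentially.
          k n = (real n)\<^sup>2 / (4 * ln (real n)) * (1 + (ln (ln (real n)) + a) / ln (real n) + r n))"

end

(*
  The bus of a passenger at time j is uniform on {1..j}, and passengers are independent, so the
  probability of detachment at time j is the birthday product (1 - 1/j) ... (1 - (n-1)/j), which for
  j of order n^2/log n is exp(-q/j) up to a factor 1 + o(1), where q = n(n-1)/2. The derivative of
  x^2/q * exp(-q/x) is (1 + 2x/q) * exp(-q/x), and x/q tends to 0 in the critical window, so
  e(n,k) ~ k^2/q * exp(-q/k). At k = n^2/(4 log n) * (1 + (log log n + a)/log n + ...) the exponent
  is q/k = 2 log n - 2 log log n - 2a + o(1), which makes this quantity converge to exp(2a)/8.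
*)

theory Submission
  imports Defs "HOL-Real_Asymp.Real_Asymp"
begin

section \<open>The law of the process at a fixed time\<close>

lemma bus_in_range: "1 \<le> k \<Longrightarrow> bus \<omega> i k \<in> {1..k}"
proof (induction k rule: nat_induct_at_least)
  case (Suc k)
  then show ?case by auto
qed auto

text \<open>Only the last successful coin matters: coin \<open>b\<close> succeeds, later ones fail,
  earlier ones are free. Since there is no coin with index 1, the case \<open>b = 1\<close> says
  that all coins fail. Stating this coordinate by coordinate presents the event as a
  cylinder.\<close>

lemma bus_eq_iff:
  assumes "1 \<le> b" "b \<le> k"
  shows "bus \<omega> i k = b \<longleftrightarrow>
    (\<forall>l\<in>{2..k}. \<omega> (i, l) \<in> (if l < b then UNIV else if l = b then {True} else {False}))"
  using assms
proof (induction k)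
  case (Suc k)
  have split: "{2..Suc k} = (if Suc k \<ge> 2 then insert (Suc k) {2..k} else {})"
    by auto
  show ?case
  proof (cases "k = 0")
    case True
    with Suc.prems show ?thesis by auto
  next
    case False
    then have range: "bus \<omega> i k \<in> {1..k}"
      using bus_in_range[of k] by auto
    show ?thesis
    proof (cases "b = Suc k")
      case True
      then show ?thesis using False range by (auto simp: split)
    next
      case neq: False
      then have "b \<le> k" using Suc.prems by simp
      from Suc.IH[OF \<open>1 \<le> b\<close> this] show ?thesis
        using False neq \<open>b \<le> k\<close> by (auto simp: split)
    qed
  qed
qed auto

lemma detached_iff_inj_on: "detached n \<omega> k \<longleftrightarrow> inj_on (\<lambda>i. bus \<omega> i k) {..<n}"
proof -
  have "detached n \<omega> k \<longleftrightarrow> {i. i < n \<and> lonely n \<omega> k i} = {..<n}"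
  proof
    assume "detached n \<omega> k"
    then show "{i. i < n \<and> lonely n \<omega> k i} = {..<n}"
      unfolding detached_def num_lonely_def by (intro card_subset_eq) auto
  next
    assume "{i. i < n \<and> lonely n \<omega> k i} = {..<n}"
    then show "detached n \<omega> k"
      unfolding detached_def num_lonely_def by simp
  qed
  then show ?thesis
    by (auto simp: lonely_def inj_on_def set_eq_iff)
qed

section \<open>Cylinder events of the coin space\<close>

definition coin :: "nat \<times> nat \<Rightarrow> bool measure" where
  "coin = (\<lambda>(i, k). measure_pmf (bernoulli_pmf (1 / real k)))"

interpretation coins: product_prob_space coin "{..<n} \<times> {2..}" for n
  by (rule product_prob_spaceI)
     (auto simp: coin_def intro: measure_pmf.prob_space_axioms split: prod.splits)

lemma relocation_coins_eq: "relocation_coins n = PiM ({..<n} \<times> {2..}) coin"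
  by (simp add: relocation_coins_def coin_def)

interpretation relocation: prob_space "relocation_coins n" for n
  unfolding relocation_coins_eq by (rule coins.P.prob_space_axioms)

text \<open>The product telescopes: \<open>1/b\<close> times the factors \<open>(l - 1)/l\<close>
  for \<open>b < l\<close> leaves \<open>1/k\<close>. For \<open>b = 1\<close> the factor
  \<open>1/b\<close> is absent and equals 1 anyway. So the bus at time \<open>k\<close> is uniform
  on \<open>{1..k}\<close>.\<close>

lemma prod_coin_bus:
  assumes "1 \<le> b" "b \<le> k"
  shows "(\<Prod>l=2..k. measure (coin (i, l))
      (if l < b then UNIV else if l = b then {True} else {False})) = 1 / real k"
  using assms
proof (induction k)
  case (Suc k)
  let ?A = "\<lambda>l. if l < b then UNIV else if l = b then {True} else {False}"
  show ?case
  proof (cases "k = 0")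
    case True
    with Suc.prems show ?thesis by auto
  next
    case False
    then have split: "{2..Suc k} = insert (Suc k) {2..k}"
      by auto
    show ?thesis
    proof (cases "b = Suc k")
      case True
      have "(\<Prod>l=2..k. measure (coin (i, l)) (?A l)) = (\<Prod>l=2..k. 1)"
        using True by (intro prod.cong) (auto simp: coin_def)
      then show ?thesis using True False
        by (simp add: split coin_def measure_pmf_single)
    next
      case neq: False
      then have "b \<le> k" using Suc.prems by simp
      from Suc.IH[OF \<open>1 \<le> b\<close> this] show ?thesis
        using False neq \<open>b \<le> k\<close>
        by (simp add: split coin_def measure_pmf_single field_simps)
    qed
  qed
qed auto

definition bus_event :: "nat \<Rightarrow> nat \<Rightarrow> (nat \<Rightarrow> nat) \<Rightarrow> (nat \<times> nat \<Rightarrow> bool) set" where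
  "bus_event n k b = {\<omega> \<in> space (relocation_coins n). \<forall>i<n. bus \<omega> i k = b i}"

lemma
  assumes b: "b \<in> {..<n} \<rightarrow>\<^sub>E {1..k}"
  shows sets_bus_event: "bus_event n k b \<in> sets (relocation_coins n)"
    and measure_bus_event: "measure (relocation_coins n) (bus_event n k b) = (1 / real k) ^ n"
proof -
  define A where "A = (\<lambda>(i, l). if l < b i then UNIV else if l = b i then {True} else {False})"
  let ?J = "{..<n} \<times> {2..k}"
  have range: "1 \<le> b i" "b i \<le> k" if "i < n" for i
    using b that by (auto simp: PiE_iff)
  \<comment> \<open>Positions at time \<open>k\<close> depend only on the finitely many coins up to
    time \<open>k\<close>, so the event is a box over \<open>?J\<close>, and its measure factors
    over passengers and times.\<close>
  have "bus_event n k b = prod_emb ({..<n} \<times> {2..}) coin ?J (Pi\<^sub>E ?J A)"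
    by (subst prod_emb_PiE)
       (fastforce simp: bus_event_def relocation_coins_eq space_PiM coin_def A_def PiE_iff
          bus_eq_iff[OF range] extensional_def split: if_splits)+
  note event = this
  have sets_A: "A x \<in> sets (coin x)" for x
    by (auto simp: coin_def split: prod.splits)
  show "bus_event n k b \<in> sets (relocation_coins n)"
    unfolding event relocation_coins_eq using sets_A by (intro sets_PiM_I) auto
  have "measure (relocation_coins n) (bus_event n k b) = (\<Prod>x\<in>?J. measure (coin x) (A x))"
    unfolding event relocation_coins_eq using sets_A by (intro coins.measure_PiM_emb) auto
  also have "\<dots> = (\<Prod>i<n. \<Prod>l=2..k. measure (coin (i, l)) (A (i, l)))"
    by (simp add: prod.cartesian_product)
  also have "\<dots> = (\<Prod>i<n. 1 / real k)"
    using range by (intro prod.cong) (auto simp: A_def prod_coin_bus)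
  finally show "measure (relocation_coins n) (bus_event n k b) = (1 / real k) ^ n"
    by simp
qed

text \<open>The birthday probability that \<open>n\<close> independent uniform draws from
  \<open>j\<close> values are all distinct.\<close>

definition detach_prob :: "nat \<Rightarrow> nat \<Rightarrow> real" where
  "detach_prob n j = (\<Prod>i<n. 1 - real i / real j)"

lemma detach_prob_eq_0: "1 \<le> j \<Longrightarrow> j < n \<Longrightarrow> detach_prob n j = 0"
  unfolding detach_prob_def by (rule prod_zero) auto

lemma
  assumes j: "1 \<le> j"
  shows sets_detached: "{\<omega> \<in> space (relocation_coins n). detached n \<omega> j} \<in> sets (relocation_coins n)"
    and measure_detached:
      "measure (relocation_coins n) {\<omega> \<in> space (relocation_coins n). detached n \<omega> j} = detach_prob n j"
proof -
  \<comment> \<open>Extensional functions are used so that two different \<open>b\<close> differ at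
    some passenger below \<open>n\<close>; this makes their events disjoint.\<close>
  let ?B = "{b \<in> {..<n} \<rightarrow>\<^sub>E {1..j}. inj_on b {..<n}}"
  have fin: "finite ?B"
    by (rule finite_subset[OF _ finite_PiE[of "{..<n}" "\<lambda>_. {1..j}"]]) auto
  have event: "{\<omega> \<in> space (relocation_coins n). detached n \<omega> j} = (\<Union>b\<in>?B. bus_event n j b)"
  proof (intro equalityI subsetI)
    fix \<omega> assume *: "\<omega> \<in> {\<omega> \<in> space (relocation_coins n). detached n \<omega> j}"
    let ?b = "restrict (\<lambda>i. bus \<omega> i j) {..<n}"
    have "?b \<in> ?B" "\<omega> \<in> bus_event n j ?b"
      using * bus_in_range[OF j]
      by (auto simp: bus_event_def detached_iff_inj_on inj_on_restrict_eq)
    then show "\<omega> \<in> (\<Union>b\<in>?B. bus_event n j b)" by blast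
  next
    fix \<omega> assume "\<omega> \<in> (\<Union>b\<in>?B. bus_event n j b)"
    then show "\<omega> \<in> {\<omega> \<in> space (relocation_coins n). detached n \<omega> j}"
      by (auto simp: bus_event_def detached_iff_inj_on inj_on_def)
  qed
  have sets: "bus_event n j ` ?B \<subseteq> sets (relocation_coins n)"
    using sets_bus_event by blast
  show "{\<omega> \<in> space (relocation_coins n). detached n \<omega> j} \<in> sets (relocation_coins n)"
    unfolding event using fin sets by blast
  have "disjoint_family_on (bus_event n j) ?B"
    by (auto simp: disjoint_family_on_def bus_event_def PiE_iff extensional_def fun_eq_iff) metis
  then have "measure (relocation_coins n) {\<omega> \<in> space (relocation_coins n). detached n \<omega> j} =
      (\<Sum>b\<in>?B. measure (relocation_coins n) (bus_event n j b))"
    unfolding event using fin sets by (rule relocation.finite_measure_finite_Union[rotated 2])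
  also have "\<dots> = (\<Sum>b\<in>?B. (1 / real j) ^ n)"
    using measure_bus_event by (intro sum.cong) auto
  \<comment> \<open>The injections are counted by a falling factorial, here with truncated
    subtraction on naturals.\<close>
  also have "\<dots> = real (\<Prod>i<n. j - i) * (1 / real j) ^ n"
    using card_inj_on_subset_funcset[of "{..<n}" "{1..j}" "{..<n}"]
    by (simp add: lessThan_atLeast0)
  also have "\<dots> = detach_prob n j"
  \<comment> \<open>If \<open>j < n\<close>, the factor at \<open>i = j\<close> makes both products
    vanish; otherwise the truncated subtraction is exact.\<close>
  proof (cases "j < n")
    case True
    then have "(\<Prod>i<n. j - i) = 0" by (intro prod_zero) auto
    then show ?thesis using detach_prob_eq_0[OF j True] by simp
  next
    case False
    have "real (\<Prod>i<n. j - i) * (1 / real j) ^ n = (\<Prod>i<n. real (j - i) / real j)"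
      by (simp add: prod_dividef power_divide)
    also have "\<dots> = detach_prob n j"
      unfolding detach_prob_def using False j by (intro prod.cong) (auto simp: field_simps of_nat_diff)
    finally show ?thesis .
  qed
  finally show "measure (relocation_coins n) {\<omega> \<in> space (relocation_coins n). detached n \<omega> j} =
      detach_prob n j" .
qed

text \<open>Linearity of expectation, with the count written as a sum of indicators. Time 0 must be
  kept out of \<open>J\<close>: there division by zero would make \<open>detach_prob\<close> equal
  to 1, while all passengers sit in bus 1.\<close>

lemma expected_detachments_eq_sum:
  assumes J: "finite J" "J \<subseteq> {1..}"
  shows "expected_detachments n J = (\<Sum>j\<in>J. detach_prob n j)"
proof -
  let ?M = "relocation_coins n"
  let ?D = "\<lambda>j. {\<omega> \<in> space ?M. detached n \<omega> j}"
  have "expected_detachments n J = (\<integral>\<omega>. (\<Sum>j\<in>J. indicator (?D j) \<omega>) \<partial>?M)"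
    unfolding expected_detachments_def
  proof (intro Bochner_Integration.integral_cong refl)
    fix \<omega> assume \<omega>: "\<omega> \<in> space ?M"
    have "(\<Sum>j\<in>J. indicator (?D j) \<omega> :: real) = (\<Sum>j\<in>J. if detached n \<omega> j then 1 else 0)"
      using \<omega> by (intro sum.cong) (auto simp: indicator_def)
    also have "\<dots> = real (card {j \<in> J. detached n \<omega> j})"
      using J(1) by (simp add: sum.If_cases Int_def)
    finally show "real (card {j \<in> J. detached n \<omega> j}) = (\<Sum>j\<in>J. indicator (?D j) \<omega>)" ..
  qed
  also have "\<dots> = (\<Sum>j\<in>J. \<integral>\<omega>. indicator (?D j) \<omega> \<partial>?M)"
    using J sets_detached
    by (intro Bochner_Integration.integral_sum integrable_real_indicator relocation.emeasure_finite)
       (auto simp: less_top[symmetric])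
  also have "\<dots> = (\<Sum>j\<in>J. detach_prob n j)"
    using J measure_detached[of _ n] sets_detached[of _ n]
    by (intro sum.cong) (auto simp: sets.Int_space_eq2)
  finally show ?thesis .
qed

lemma e_eq_sum: "e n k = (\<Sum>j=1..nat \<lfloor>k\<rfloor>. detach_prob n j)"
  unfolding e_def by (rule expected_detachments_eq_sum) auto

section \<open>Exponential bounds for the birthday product\<close>

definition num_pairs :: "nat \<Rightarrow> real" where
  "num_pairs n = real n * (real n - 1) / 2"

lemma sum_lessThan_eq_num_pairs: "(\<Sum>i<n. real i) = num_pairs n"
  by (induction n) (auto simp: num_pairs_def field_simps)

lemma detach_prob_nonneg: "1 \<le> j \<Longrightarrow> 0 \<le> detach_prob n j"
proof (cases "j < n")
  case False
  assume "1 \<le> j"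
  then show ?thesis
    using False unfolding detach_prob_def by (intro prod_nonneg) auto
qed (simp add: detach_prob_eq_0)

text \<open>Apply \<open>1 - x \<le> exp (- x)\<close> to each factor. Comparing products needs
  nonnegative factors, hence the separate case \<open>j < n\<close>, where the product is 0.\<close>

lemma detach_prob_le:
  assumes "1 \<le> j"
  shows "detach_prob n j \<le> exp (- num_pairs n / real j)"
proof (cases "j < n")
  case False
  have "detach_prob n j \<le> (\<Prod>i<n. exp (- (real i / real j)))"
    unfolding detach_prob_def
  proof (rule prod_mono)
    fix i assume "i \<in> {..<n}"
    then show "0 \<le> 1 - real i / real j \<and> 1 - real i / real j \<le> exp (- (real i / real j))"
      using assms False exp_ge_add_one_self[of "- (real i / real j)"] by auto
  qed
  also have "\<dots> = exp (- num_pairs n / real j)"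
    by (simp add: exp_sum[symmetric] sum_negf sum_divide_distrib[symmetric] sum_lessThan_eq_num_pairs)
  finally show ?thesis .
qed (use detach_prob_eq_0[of j n] assms in simp)

text \<open>For \<open>x\<close> in \<open>[0, 1/2]\<close> one has
  \<open>ln (1 - x) \<ge> - x - 2 * x^2\<close>, and \<open>2 * n \<le> j\<close> puts every
  \<open>i / j\<close> in that range. Each of the \<open>n\<close> quadratic terms is at most
  \<open>2 * (n / j)^2\<close>, which yields the first exponential.\<close>

lemma detach_prob_ge:
  assumes j: "1 \<le> j" "2 * n \<le> j"
  shows "exp (- 2 * real n ^ 3 / (real j)\<^sup>2) * exp (- num_pairs n / real j) \<le> detach_prob n j"
proof -
  have le: "real i / real j \<le> real n / real j" if "i < n" for i
    using that by (simp add: divide_right_mono)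
  have half: "real n / real j \<le> 1 / 2"
    using j by (simp add: field_simps)
  have "(\<Sum>i<n. (real i / real j)\<^sup>2) \<le> (\<Sum>i<n. (real n / real j)\<^sup>2)"
    using le by (intro sum_mono power_mono) auto
  also have "\<dots> = real n ^ 3 / (real j)\<^sup>2"
    by (simp add: power_divide eval_nat_numeral)
  finally have sq: "(\<Sum>i<n. (real i / real j)\<^sup>2) \<le> real n ^ 3 / (real j)\<^sup>2" .
  have "(\<Sum>i<n. - (real i / real j) - 2 * (real i / real j)\<^sup>2) =
      - num_pairs n / real j - 2 * (\<Sum>i<n. (real i / real j)\<^sup>2)"
    by (simp add: sum_subtractf sum_negf sum_divide_distrib[symmetric] sum_distrib_left[symmetric]
        sum_lessThan_eq_num_pairs)
  with sq have "exp (- 2 * real n ^ 3 / (real j)\<^sup>2) * exp (- num_pairs n / real j) \<le>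
      exp (\<Sum>i<n. - (real i / real j) - 2 * (real i / real j)\<^sup>2)"
    by (simp add: exp_add[symmetric])
  also have "\<dots> = (\<Prod>i<n. exp (- (real i / real j) - 2 * (real i / real j)\<^sup>2))"
    by (simp add: exp_sum)
  also have "\<dots> \<le> detach_prob n j"
    unfolding detach_prob_def
  proof (intro prod_mono conjI)
    fix i assume "i \<in> {..<n}"
    then have i: "real i / real j \<le> 1 / 2" using order.trans[OF le half] by simp
    then have "exp (- (real i / real j) - 2 * (real i / real j)\<^sup>2) \<le> exp (ln (1 - real i / real j))"
      using ln_one_minus_pos_lower_bound[of "real i / real j"] by (simp del: exp_ln)
    also have "\<dots> = 1 - real i / real j" using i by (intro exp_ln) linarith
    finally show "exp (- (real i / real j) - 2 * (real i / real j)\<^sup>2) \<le> 1 - real i / real j" .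
  qed auto
  finally show ?thesis .
qed

section \<open>Bounds on the expected number of detachments\<close>

definition Phi :: "real \<Rightarrow> real \<Rightarrow> real" where
  "Phi q x = x\<^sup>2 / q * exp (- q / x)"

lemma Phi_nonneg: "0 < q \<Longrightarrow> 0 \<le> Phi q x"
  by (simp add: Phi_def)

lemma exp_divide_mono: "0 < q \<Longrightarrow> 0 < x \<Longrightarrow> x \<le> y \<Longrightarrow> exp (- q / x) \<le> exp (- q / y)" for q x y :: real
  by (simp add: divide_left_mono)

lemma Phi_mono: "0 < q \<Longrightarrow> 0 < x \<Longrightarrow> x \<le> y \<Longrightarrow> Phi q x \<le> Phi q y"
  unfolding Phi_def
  by (intro mult_mono divide_right_mono power_mono exp_divide_mono) auto

lemma Phi_has_derivative:
  assumes "0 < q" "0 < x"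
  shows "(Phi q has_real_derivative (1 + 2 * x / q) * exp (- q / x)) (at x)"
  unfolding Phi_def using assms
  by (auto intro!: derivative_eq_intros simp: field_simps power2_eq_square)

lemma Phi_diff_eq:
  assumes "0 < q" "0 < x" "x < y"
  obtains z where "x < z" "z < y" "Phi q y - Phi q x = (y - x) * ((1 + 2 * z / q) * exp (- q / z))"
  using MVT2[OF \<open>x < y\<close>, of "Phi q" "\<lambda>z. (1 + 2 * z / q) * exp (- q / z)"] assms
    Phi_has_derivative[OF \<open>0 < q\<close>] by auto

text \<open>By the mean value theorem the increment is the derivative at some \<open>z > x\<close>;
  its factor \<open>1 + 2 * z / q\<close> is at least 1 and its exponential is increasing.\<close>

lemma Phi_step_ge:
  assumes "0 < q" "0 < x"
  shows "exp (- q / x) \<le> Phi q (x + 1) - Phi q x"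
proof -
  obtain z where z: "x < z" "z < x + 1"
    "Phi q (x + 1) - Phi q x = (x + 1 - x) * ((1 + 2 * z / q) * exp (- q / z))"
    using Phi_diff_eq[of q x "x + 1"] assms by auto
  have "1 * exp (- q / x) \<le> (1 + 2 * z / q) * exp (- q / z)"
    using assms z by (intro mult_mono exp_divide_mono) auto
  with z show ?thesis by simp
qed

text \<open>The bound \<open>B\<close> replaces the intermediate point in the factor
  \<open>1 + 2 * z / q\<close>, so that one constant serves all steps and can be pulled out of the
  sum.\<close>

lemma Phi_step_le:
  assumes "0 < q" "0 < x" "x + 1 \<le> B"
  shows "Phi q (x + 1) - Phi q x \<le> (1 + 2 * B / q) * exp (- q / (x + 1))"
proof -
  obtain z where z: "x < z" "z < x + 1"
    "Phi q (x + 1) - Phi q x = (x + 1 - x) * ((1 + 2 * z / q) * exp (- q / z))"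
    using Phi_diff_eq[of q x "x + 1"] assms by auto
  have "(1 + 2 * z / q) * exp (- q / z) \<le> (1 + 2 * B / q) * exp (- q / (x + 1))"
    using assms z by (intro mult_mono exp_divide_mono add_left_mono divide_right_mono) auto
  with z show ?thesis by simp
qed

text \<open>Telescoping: the term at \<open>j\<close> is paid for by the increment of
  \<open>Phi\<close> from \<open>j\<close> to \<open>j + 1\<close>. The term at \<open>K\<close> is
  left over and appears as the extra summand.\<close>

lemma sum_exp_le:
  assumes "0 < q" "1 \<le> K"
  shows "(\<Sum>j=1..K. exp (- q / real j)) \<le> Phi q (real K) + exp (- q / real K)"
  using assms(2)
proof (induction K rule: nat_induct_at_least)
  case base
  then show ?case using assms by (simp add: Phi_nonneg)
next
  case (Suc K)
  then show ?case using Phi_step_ge[of q "real K"] assms by (simp add: add.commute)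
qed

text \<open>Telescoping again, now matching the term at \<open>j\<close> with the increment of
  \<open>Phi\<close> from \<open>j - 1\<close> to \<open>j\<close>.\<close>

lemma sum_exp_ge:
  assumes "0 < q" "1 \<le> M" "M \<le> K" "real K \<le> B"
  shows "Phi q (real K) - Phi q (real M) \<le> (1 + 2 * B / q) * (\<Sum>j\<in>{M<..K}. exp (- q / real j))"
  using assms(3,4)
proof (induction K rule: nat_induct_at_least)
  case (Suc K)
  have "{M<..Suc K} = insert (Suc K) {M<..K}" using Suc by auto
  then show ?case using Suc Phi_step_le[of q "real K" B] assms(1,2)
    by (simp add: add.commute distrib_left)
qed simp

lemma e_le:
  assumes "2 \<le> n" "1 \<le> k"
  shows "e n k \<le> Phi (num_pairs n) k + exp (- num_pairs n / k)"
proof -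
  let ?q = "num_pairs n" and ?K = "nat \<lfloor>k\<rfloor>"
  have q: "0 < ?q" using assms by (simp add: num_pairs_def)
  have K: "1 \<le> ?K" "real ?K \<le> k" using assms by linarith+
  have "e n k \<le> (\<Sum>j=1..?K. exp (- ?q / real j))"
    unfolding e_eq_sum by (intro sum_mono detach_prob_le) auto
  also have "\<dots> \<le> Phi ?q (real ?K) + exp (- ?q / real ?K)"
    by (rule sum_exp_le[OF q K(1)])
  also have "\<dots> \<le> Phi ?q k + exp (- ?q / k)"
    using q K by (intro add_mono Phi_mono exp_divide_mono) auto
  finally show ?thesis .
qed

text \<open>Times up to about \<open>k / 2\<close> are discarded. For the remaining ones
  \<open>j \<ge> k / 4\<close>, so the correction \<open>2 * n^3 / j^2\<close> is at most
  \<open>32 * n^3 / k^2\<close> uniformly, and \<open>8 * n \<le> k\<close> gives the condition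
  \<open>2 * n \<le> j\<close> of \<open>detach_prob_ge\<close>. The argument \<open>k - 1\<close>
  pays for rounding \<open>k\<close> down.\<close>

lemma e_ge:
  assumes "2 \<le> n" "8 * real n \<le> k"
  shows "exp (- 32 * real n ^ 3 / k\<^sup>2) * (Phi (num_pairs n) (k - 1) - Phi (num_pairs n) (k / 2)) /
    (1 + 2 * k / num_pairs n) \<le> e n k"
proof -
  let ?q = "num_pairs n" and ?K = "nat \<lfloor>k\<rfloor>" and ?M = "nat \<lfloor>k / 2\<rfloor>"
  have q: "0 < ?q" using assms by (simp add: num_pairs_def)
  have k: "16 \<le> k" using assms by linarith
  have K: "k - 1 \<le> real ?K" "real ?K \<le> k" using k by linarith+
  have M: "k / 4 \<le> real ?M" "real ?M \<le> k / 2" using k by linarith+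
  have M1: "1 \<le> ?M" "?M \<le> ?K" "2 * n \<le> ?M"
    using k assms M K by linarith+
  have "Phi ?q (k - 1) - Phi ?q (k / 2) \<le> Phi ?q (real ?K) - Phi ?q (real ?M)"
    using q k K M M1 by (intro diff_mono Phi_mono) auto
  also have "\<dots> \<le> (1 + 2 * k / ?q) * (\<Sum>j\<in>{?M<..?K}. exp (- ?q / real j))"
    by (rule sum_exp_ge[OF q M1(1,2) K(2)])
  finally have "(Phi ?q (k - 1) - Phi ?q (k / 2)) / (1 + 2 * k / ?q) \<le>
      (\<Sum>j\<in>{?M<..?K}. exp (- ?q / real j))"
    using q k by (subst pos_divide_le_eq) (auto simp: mult.commute intro: add_pos_nonneg)
  then have "exp (- 32 * real n ^ 3 / k\<^sup>2) * ((Phi ?q (k - 1) - Phi ?q (k / 2)) / (1 + 2 * k / ?q)) \<le>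
      exp (- 32 * real n ^ 3 / k\<^sup>2) * (\<Sum>j\<in>{?M<..?K}. exp (- ?q / real j))"
    by (intro mult_left_mono) auto
  also have "\<dots> \<le> (\<Sum>j\<in>{?M<..?K}. detach_prob n j)"
    unfolding sum_distrib_left
  proof (rule sum_mono)
    fix j assume j: "j \<in> {?M<..?K}"
    have "k / 4 \<le> real j" using j M by auto
    then have "(k / 4)\<^sup>2 \<le> (real j)\<^sup>2" using k by (intro power_mono) auto
    then have "2 * real n ^ 3 / (real j)\<^sup>2 \<le> 2 * real n ^ 3 / (k / 4)\<^sup>2"
      using k \<open>k / 4 \<le> real j\<close> by (intro divide_left_mono mult_pos_pos zero_less_power) auto
    then have "exp (- 32 * real n ^ 3 / k\<^sup>2) \<le> exp (- 2 * real n ^ 3 / (real j)\<^sup>2)"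
      by (simp add: power_divide)
    then have "exp (- 32 * real n ^ 3 / k\<^sup>2) * exp (- ?q / real j) \<le>
        exp (- 2 * real n ^ 3 / (real j)\<^sup>2) * exp (- ?q / real j)"
      by (rule mult_right_mono) simp
    also have "\<dots> \<le> detach_prob n j"
      using j M1 by (intro detach_prob_ge) auto
    finally show "exp (- 32 * real n ^ 3 / k\<^sup>2) * exp (- ?q / real j) \<le> detach_prob n j" .
  qed
  also have "\<dots> \<le> e n k"
    unfolding e_eq_sum using M1 by (intro sum_mono2 detach_prob_nonneg) auto
  finally show ?thesis by simp
qed

section \<open>Asymptotics in the critical window\<close>

text \<open>The exponent \<open>q / k\<close> magnifies the relative remainder by
  \<open>2 * ln n\<close>, so what matters is that \<open>r\<close> stays negligible after
  multiplication by \<open>ln n\<close>.\<close>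

lemma critical_expansionD:
  assumes "critical_expansion a k"
  obtains r where "(\<lambda>n. ln (real n) * r n) \<longlonglongrightarrow> 0"
    "\<forall>\<^sub>F n in sequentially.
      k n = (real n)\<^sup>2 / (4 * ln (real n)) * (1 + (ln (ln (real n)) + a) / ln (real n) + r n)"
proof -
  obtain r where r: "r \<in> O(\<lambda>n. (ln (ln (real n)) / ln (real n))\<^sup>2)"
    and k: "\<forall>\<^sub>F n in sequentially.
      k n = (real n)\<^sup>2 / (4 * ln (real n)) * (1 + (ln (ln (real n)) + a) / ln (real n) + r n)"
    using assms unfolding critical_expansion_def by blast
  have "(\<lambda>n. ln (real n) * r n) \<in> O(\<lambda>n. ln (real n) * (ln (ln (real n)) / ln (real n))\<^sup>2)"
    by (intro landau_o.big.mult r) simp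
  also have "(\<lambda>n. ln (real n) * (ln (ln (real n)) / ln (real n))\<^sup>2) \<in> o(\<lambda>_. 1)"
    by real_asymp
  finally have "(\<lambda>n. ln (real n) * r n) \<longlonglongrightarrow> 0"
    by (simp add: smalloD_tendsto[where g = "\<lambda>_. 1", simplified])
  from that[OF this k] show thesis .
qed

text \<open>A bounded change of \<open>k\<close> is a relative change of order
  \<open>ln n / n^2\<close>, far below the permitted remainder. This absorbs roundings to integers
  and shifts by one.\<close>

lemma critical_expansion_shift:
  assumes "critical_expansion a k" and close: "\<forall>\<^sub>F n in sequentially. \<bar>k' n - k n\<bar> \<le> 1"
  shows "critical_expansion a k'"
proof -
  obtain r where r: "r \<in> O(\<lambda>n. (ln (ln (real n)) / ln (real n))\<^sup>2)"
    and k: "\<forall>\<^sub>F n in sequentially.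
      k n = (real n)\<^sup>2 / (4 * ln (real n)) * (1 + (ln (ln (real n)) + a) / ln (real n) + r n)"
    using assms unfolding critical_expansion_def by blast
  let ?s = "\<lambda>n. (k' n - k n) * (4 * ln (real n) / (real n)\<^sup>2)"
  have "(\<lambda>n. k' n - k n) \<in> O(\<lambda>_. 1)"
    using close by (intro bigoI[of _ 1]) simp
  then have "?s \<in> O(\<lambda>n. 1 * (4 * ln (real n) / (real n)\<^sup>2))"
    by (intro landau_o.big.mult) simp_all
  also have "(\<lambda>n. 1 * (4 * ln (real n) / (real n)\<^sup>2)) \<in> O(\<lambda>n. (ln (ln (real n)) / ln (real n))\<^sup>2)"
    by real_asymp
  finally have "(\<lambda>n. r n + ?s n) \<in> O(\<lambda>n. (ln (ln (real n)) / ln (real n))\<^sup>2)"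
    using r by (rule sum_in_bigo(1)[rotated])
  moreover have "\<forall>\<^sub>F n in sequentially. k' n =
      (real n)\<^sup>2 / (4 * ln (real n)) * (1 + (ln (ln (real n)) + a) / ln (real n) + (r n + ?s n))"
    using k eventually_gt_at_top[of 1]
  proof eventually_elim
    case (elim n)
    then have "0 < ln (real n)" by simp
    then have "(real n)\<^sup>2 / (4 * ln (real n)) * ?s n = k' n - k n"
      using elim by simp
    with elim show ?case
      by (simp only: distrib_left)
  qed
  ultimately show ?thesis
    unfolding critical_expansion_def by (intro bexI[where x = "\<lambda>n. r n + ?s n"])
qed

section \<open>Limits along a fixed critical expansion\<close>

context
  fixes a :: real and k :: "nat \<Rightarrow> real"
  assumes k: "critical_expansion a k"
begin

lemma scale_tendsto: "(\<lambda>n. k n * (4 * ln (real n) / (real n)\<^sup>2)) \<longlonglongrightarrow> 1"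
  and exponent_tendsto:
    "(\<lambda>n. num_pairs n / k n - 2 * ln (real n) + 2 * ln (ln (real n))) \<longlonglongrightarrow> - 2 * a"
proof -
  obtain r where r: "(\<lambda>n. ln (real n) * r n) \<longlonglongrightarrow> 0"
    and k_eq: "\<forall>\<^sub>F n in sequentially.
      k n = (real n)\<^sup>2 / (4 * ln (real n)) * (1 + (ln (ln (real n)) + a) / ln (real n) + r n)"
    using critical_expansionD[OF k] .
  \<comment> \<open>The total relative deviation of \<open>k\<close> from
    \<open>n^2 / (4 * ln n)\<close>. The rate \<open>sqrt (ln n) * v \<longrightarrow> 0\<close>,
    shown next, is what kills the quadratic term \<open>ln n * v^2\<close> of the exponent.\<close>
  define v where "v = (\<lambda>n::nat. (ln (ln (real n)) + a) / ln (real n) + r n)"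
  have "(\<lambda>n. sqrt (ln (real n)) * ((ln (ln (real n)) + a) / ln (real n)) +
      1 / sqrt (ln (real n)) * (ln (real n) * r n)) \<longlonglongrightarrow> 0 + 0 * 0"
    by (intro tendsto_add tendsto_mult r; real_asymp)
  moreover have "\<forall>\<^sub>F n in sequentially. sqrt (ln (real n)) * ((ln (ln (real n)) + a) / ln (real n)) +
      1 / sqrt (ln (real n)) * (ln (real n) * r n) = sqrt (ln (real n)) * v n"
    using eventually_gt_at_top[of 1]
    proof eventually_elim
    case (elim n)
    then have "1 / sqrt (ln (real n)) * ln (real n) = sqrt (ln (real n))"
      by (simp add: real_div_sqrt)
    then show ?case by (simp add: v_def distrib_left flip: mult.assoc)
  qed
  ultimately have sv: "(\<lambda>n. sqrt (ln (real n)) * v n) \<longlonglongrightarrow> 0"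
    by (simp add: tendsto_cong)
  have "(\<lambda>n. 1 / sqrt (ln (real n)) * (sqrt (ln (real n)) * v n)) \<longlonglongrightarrow> 0 * 0"
    by (intro tendsto_mult sv) real_asymp
  moreover have "\<forall>\<^sub>F n in sequentially. 1 / sqrt (ln (real n)) * (sqrt (ln (real n)) * v n) = v n"
    using eventually_gt_at_top[of 1] by eventually_elim simp
  ultimately have v: "v \<longlonglongrightarrow> 0"
    by (simp add: tendsto_cong)
  then have u: "(\<lambda>n. 1 + v n) \<longlonglongrightarrow> 1"
    using tendsto_add[OF tendsto_const[of 1] v] by simp
  then have u_pos: "\<forall>\<^sub>F n in sequentially. 0 < 1 + v n"
    by (rule order_tendstoD) simp
  have "\<forall>\<^sub>F n in sequentially. k n * (4 * ln (real n) / (real n)\<^sup>2) = 1 + v n"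
    using k_eq eventually_gt_at_top[of 1]
  proof eventually_elim
    case (elim n)
    then have "0 < ln (real n)" by simp
    with elim show ?case by (simp add: v_def add.assoc)
  qed
  with u show "(\<lambda>n. k n * (4 * ln (real n) / (real n)\<^sup>2)) \<longlonglongrightarrow> 1"
    by (simp add: tendsto_cong)
  \<comment> \<open>The exponent after \<open>2 * ln n - 2 * ln (ln n)\<close> has been removed: the
    linear term in \<open>v\<close> leaves the first two summands, the quadratic one gives the
    third, and the difference between \<open>num_pairs n\<close> and \<open>n^2 / 2\<close> gives
    the last.\<close>
  have "(\<lambda>n. - 2 * a - 2 * (ln (real n) * r n) + 2 * (sqrt (ln (real n)) * v n)\<^sup>2 / (1 + v n) -
      2 * ln (real n) / real n / (1 + v n)) \<longlonglongrightarrow> - 2 * a - 2 * 0 + 2 * 0\<^sup>2 / 1 - 0 / 1"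
    by (intro tendsto_intros r sv u) (simp_all, real_asymp)
  moreover have "\<forall>\<^sub>F n in sequentially. - 2 * a - 2 * (ln (real n) * r n) +
      2 * (sqrt (ln (real n)) * v n)\<^sup>2 / (1 + v n) - 2 * ln (real n) / real n / (1 + v n) =
      num_pairs n / k n - 2 * ln (real n) + 2 * ln (ln (real n))"
    using k_eq u_pos eventually_gt_at_top[of 1]
  proof eventually_elim
    case (elim n)
    then have pos: "0 < ln (real n)" "0 < real n" by simp_all
    have k_eq: "k n = (real n)\<^sup>2 / (4 * ln (real n)) * (1 + v n)"
      using elim by (simp add: v_def add.assoc)
    \<comment> \<open>The exact form of \<open>1 / (1 + w) = 1 - w + w^2 / (1 + w)\<close>, used
      with \<open>x = 2 * ln n\<close>, \<open>t = 1 / n\<close> and \<open>w = v n\<close>.\<close>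
    have expand: "x * (1 - t) / (1 + w) = x - x * w + x * w\<^sup>2 / (1 + w) - x * t / (1 + w)"
      if "0 < 1 + w" for w x t :: real
    proof -
      have "x * (1 - t) = (x - x * w) * (1 + w) + x * w\<^sup>2 - x * t"
        by (simp add: algebra_simps power2_eq_square)
      then have "x * (1 - t) / (1 + w) = ((x - x * w) * (1 + w) + x * w\<^sup>2 - x * t) / (1 + w)"
        by simp
      with that show ?thesis by (simp add: add_divide_distrib diff_divide_distrib)
    qed
    have num_pairs: "num_pairs n = (real n)\<^sup>2 / 2 * (1 - 1 / real n)"
      using pos by (simp add: num_pairs_def field_simps power2_eq_square)
    have "num_pairs n / k n = 2 * ln (real n) * (1 - 1 / real n) / (1 + v n)"
      using pos unfolding k_eq num_pairs by simp
    also have "\<dots> = 2 * ln (real n) - 2 * ln (real n) * v n +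
        2 * (ln (real n) * (v n)\<^sup>2) / (1 + v n) - 2 * ln (real n) / real n / (1 + v n)"
      using expand[of "v n" "2 * ln (real n)" "1 / real n"] elim(2) by (simp add: mult.assoc)
    finally have "num_pairs n / k n = \<dots>" .
    moreover have "ln (real n) * v n = ln (ln (real n)) + a + ln (real n) * r n"
      using pos by (simp add: v_def field_simps)
    moreover have "(sqrt (ln (real n)) * v n)\<^sup>2 = ln (real n) * (v n)\<^sup>2"
      using pos by (simp add: power_mult_distrib)
    ultimately show ?case by simp
  qed
  ultimately show "(\<lambda>n. num_pairs n / k n - 2 * ln (real n) + 2 * ln (ln (real n))) \<longlonglongrightarrow> - 2 * a"
    by (simp add: tendsto_cong)
qed

lemma eventually_k_pos: "\<forall>\<^sub>F n in sequentially. 0 < k n"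
proof -
  have "\<forall>\<^sub>F n in sequentially. 0 < k n * (4 * ln (real n) / (real n)\<^sup>2)"
    by (rule order_tendstoD[OF scale_tendsto]) simp
  then show ?thesis
    using eventually_gt_at_top[of 1] by eventually_elim (simp add: zero_less_mult_iff zero_less_divide_iff)
qed

lemma exp_tendsto: "(\<lambda>n. exp (- num_pairs n / k n) * ((real n)\<^sup>2 / (ln (real n))\<^sup>2)) \<longlonglongrightarrow> exp (2 * a)"
proof -
  have "(\<lambda>n. exp (- (num_pairs n / k n - 2 * ln (real n) + 2 * ln (ln (real n))))) \<longlonglongrightarrow> exp (- (- 2 * a))"
    by (intro tendsto_intros exponent_tendsto)
  moreover have "\<forall>\<^sub>F n in sequentially.
      exp (- (num_pairs n / k n - 2 * ln (real n) + 2 * ln (ln (real n)))) =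
      exp (- num_pairs n / k n) * ((real n)\<^sup>2 / (ln (real n))\<^sup>2)"
    using eventually_gt_at_top[of 1]
  proof eventually_elim
    case (elim n)
    then have pos: "0 < ln (real n)" by simp
    have double: "exp (2 * x) = (exp x)\<^sup>2" for x :: real
      by (simp add: power2_eq_square flip: exp_add)
    have "exp (2 * ln (real n)) = (real n)\<^sup>2" "exp (2 * ln (ln (real n))) = (ln (real n))\<^sup>2"
      using elim pos by (simp_all only: double exp_ln)
    then show ?case
      using elim by (simp add: exp_diff exp_add exp_minus field_simps)
  qed
  ultimately show ?thesis by (simp add: tendsto_cong)
qed

lemma exp_tendsto_0: "(\<lambda>n. exp (- num_pairs n / k n)) \<longlonglongrightarrow> 0"
proof -
  have "(\<lambda>n. exp (- num_pairs n / k n) * ((real n)\<^sup>2 / (ln (real n))\<^sup>2) *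
      ((ln (real n))\<^sup>2 / (real n)\<^sup>2)) \<longlonglongrightarrow> exp (2 * a) * 0"
    by (intro tendsto_mult exp_tendsto) real_asymp
  moreover have "\<forall>\<^sub>F n in sequentially. exp (- num_pairs n / k n) * ((real n)\<^sup>2 / (ln (real n))\<^sup>2) *
      ((ln (real n))\<^sup>2 / (real n)\<^sup>2) = exp (- num_pairs n / k n)"
    using eventually_gt_at_top[of 1] by eventually_elim simp
  ultimately show ?thesis by (simp add: tendsto_cong)
qed

lemma Phi_tendsto: "(\<lambda>n. Phi (num_pairs n) (k n)) \<longlonglongrightarrow> exp (2 * a) / 8"
proof -
  \<comment> \<open>The constant 1/8 arises here: \<open>k^2\<close> is asymptotic to
    \<open>n^4 / (16 * (ln n)^2)\<close> and \<open>num_pairs n\<close> to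
    \<open>n^2 / 2\<close>.\<close>
  have "(\<lambda>n. (k n * (4 * ln (real n) / (real n)\<^sup>2))\<^sup>2 * ((real n)\<^sup>2 / (16 * num_pairs n)) *
      (exp (- num_pairs n / k n) * ((real n)\<^sup>2 / (ln (real n))\<^sup>2))) \<longlonglongrightarrow> 1\<^sup>2 * (1 / 8) * exp (2 * a)"
    unfolding num_pairs_def
    by (intro tendsto_mult tendsto_power scale_tendsto exp_tendsto[unfolded num_pairs_def]) real_asymp
  moreover have "\<forall>\<^sub>F n in sequentially.
      (k n * (4 * ln (real n) / (real n)\<^sup>2))\<^sup>2 * ((real n)\<^sup>2 / (16 * num_pairs n)) *
      (exp (- num_pairs n / k n) * ((real n)\<^sup>2 / (ln (real n))\<^sup>2)) = Phi (num_pairs n) (k n)"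
    using eventually_gt_at_top[of 1]
    by eventually_elim (simp add: Phi_def eval_nat_numeral)
  ultimately show ?thesis by (simp add: tendsto_cong)
qed

text \<open>Halving the argument doubles the exponent, so \<open>Phi\<close> picks up another factor
  \<open>exp (- q / k)\<close>, which tends to 0. Hence the early times dropped in
  \<open>e_ge\<close> cost nothing in the limit.\<close>

lemma Phi_half_tendsto_0: "(\<lambda>n. Phi (num_pairs n) (k n / 2)) \<longlonglongrightarrow> 0"
proof -
  have "(\<lambda>n. Phi (num_pairs n) (k n) * exp (- num_pairs n / k n) / 4) \<longlonglongrightarrow> exp (2 * a) / 8 * 0 / 4"
    by (intro tendsto_intros Phi_tendsto exp_tendsto_0) simp
  moreover have "Phi (num_pairs n) (k n) * exp (- num_pairs n / k n) / 4 = Phi (num_pairs n) (k n / 2)" for n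
    by (simp add: Phi_def power_divide mult_ac flip: exp_add)
  ultimately show ?thesis by simp
qed

lemma inverse_scale_tendsto: "(\<lambda>n. (real n)\<^sup>2 / (4 * ln (real n)) / k n) \<longlonglongrightarrow> 1"
  using tendsto_inverse[OF scale_tendsto] by (simp add: field_simps)

lemma eventually_k_ge: "\<forall>\<^sub>F n in sequentially. 8 * real n \<le> k n"
proof -
  have "(\<lambda>n. (real n)\<^sup>2 / (4 * ln (real n)) / k n * (4 * ln (real n) / real n)) \<longlonglongrightarrow> 1 * 0"
    by (intro tendsto_mult inverse_scale_tendsto) real_asymp
  then have "\<forall>\<^sub>F n in sequentially.
      (real n)\<^sup>2 / (4 * ln (real n)) / k n * (4 * ln (real n) / real n) < 1 / 8"
    by (rule order_tendstoD) simp
  then show ?thesis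
    using eventually_k_pos eventually_gt_at_top[of 1]
    by eventually_elim (simp add: field_simps power2_eq_square)
qed

end

section \<open>Limits of the expected counts\<close>

theorem e_tendsto:
  assumes k: "critical_expansion a k"
  shows "(\<lambda>n. e n (k n)) \<longlonglongrightarrow> exp (2 * a) / 8"
proof (rule tendsto_sandwich)
  \<comment> \<open>The lower bound evaluates \<open>Phi\<close> at \<open>k - 1\<close>, which has
    an expansion with the same \<open>a\<close> and hence the same limit.\<close>
  have k1: "critical_expansion a (\<lambda>n. k n - 1)"
    by (rule critical_expansion_shift[OF k]) simp
  show "\<forall>\<^sub>F n in sequentially. e n (k n) \<le> Phi (num_pairs n) (k n) + exp (- num_pairs n / k n)"
    using eventually_k_ge[OF k] eventually_ge_at_top[of 2]
    by eventually_elim (rule e_le, auto)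
  show "\<forall>\<^sub>F n in sequentially.
      exp (- 32 * real n ^ 3 / (k n)\<^sup>2) * (Phi (num_pairs n) (k n - 1) - Phi (num_pairs n) (k n / 2)) /
      (1 + 2 * k n / num_pairs n) \<le> e n (k n)"
    using eventually_k_ge[OF k] eventually_ge_at_top[of 2]
    by eventually_elim (rule e_ge, auto)
  show "(\<lambda>n. Phi (num_pairs n) (k n) + exp (- num_pairs n / k n)) \<longlonglongrightarrow> exp (2 * a) / 8"
    using tendsto_add[OF Phi_tendsto[OF k] exp_tendsto_0[OF k]] by simp
  \<comment> \<open>The product correction has order \<open>(ln n)^2 / n\<close>; the constant is
    \<open>512 = 32 * 16\<close>, the 16 coming from the square of \<open>4 * ln n\<close>.\<close>
  have "(\<lambda>n. ((real n)\<^sup>2 / (4 * ln (real n)) / k n)\<^sup>2 * (512 * (ln (real n))\<^sup>2 / real n)) \<longlonglongrightarrow> 1\<^sup>2 * 0"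
    by (intro tendsto_mult tendsto_power inverse_scale_tendsto[OF k]) real_asymp
  moreover have "\<forall>\<^sub>F n in sequentially.
      ((real n)\<^sup>2 / (4 * ln (real n)) / k n)\<^sup>2 * (512 * (ln (real n))\<^sup>2 / real n) = 32 * real n ^ 3 / (k n)\<^sup>2"
    using eventually_gt_at_top[of 1]
    by eventually_elim (simp add: power_divide power_mult_distrib eval_nat_numeral)
  ultimately have cube: "(\<lambda>n. 32 * real n ^ 3 / (k n)\<^sup>2) \<longlonglongrightarrow> 0"
    by (simp add: tendsto_cong)
  \<comment> \<open>The excess factor in the derivative of \<open>Phi\<close> is
    \<open>1 + O(1 / ln n)\<close>.\<close>
  have "(\<lambda>n. k n * (4 * ln (real n) / (real n)\<^sup>2) * ((real n)\<^sup>2 / (2 * ln (real n) * num_pairs n))) \<longlonglongrightarrow> 1 * 0"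
    unfolding num_pairs_def by (intro tendsto_mult scale_tendsto[OF k]) real_asymp
  moreover have "\<forall>\<^sub>F n in sequentially.
      k n * (4 * ln (real n) / (real n)\<^sup>2) * ((real n)\<^sup>2 / (2 * ln (real n) * num_pairs n)) =
      2 * k n / num_pairs n"
    using eventually_gt_at_top[of 1] by eventually_elim simp
  ultimately have ratio: "(\<lambda>n. 2 * k n / num_pairs n) \<longlonglongrightarrow> 0"
    by (simp add: tendsto_cong)
  have "(\<lambda>n. exp (- (32 * real n ^ 3 / (k n)\<^sup>2)) * (Phi (num_pairs n) (k n - 1) - Phi (num_pairs n) (k n / 2)) /
      (1 + 2 * k n / num_pairs n)) \<longlonglongrightarrow> exp (- 0) * (exp (2 * a) / 8 - 0) / (1 + 0)"
    by (intro tendsto_intros cube ratio Phi_tendsto[OF k1] Phi_half_tendsto_0[OF k]) simp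
  then show "(\<lambda>n. exp (- 32 * real n ^ 3 / (k n)\<^sup>2) *
      (Phi (num_pairs n) (k n - 1) - Phi (num_pairs n) (k n / 2)) /
      (1 + 2 * k n / num_pairs n)) \<longlonglongrightarrow> exp (2 * a) / 8"
    by simp
qed

text \<open>The window count is a difference of two values of \<open>e\<close>. In
  \<open>hi - lo\<close> the leading and \<open>ln (ln n)\<close> terms cancel, leaving
  \<open>n^2 / (4 * ln n)\<close> times \<open>(b - a) / ln n\<close> up to a smaller
  remainder.\<close>

theorem window_tendsto:
  assumes lo: "critical_expansion a lo" and hi: "critical_expansion b hi" and "a < b"
  shows "(\<lambda>n. expected_detachments n {j. 1 \<le> j \<and> lo n \<le> real j \<and> real j \<le> hi n})
    \<longlonglongrightarrow> (exp (2 * b) - exp (2 * a)) / 8"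
    and "(\<lambda>n. hi n - lo n) \<sim>[sequentially] (\<lambda>n. (b - a) / 4 * (real n / ln (real n))\<^sup>2)"
proof -
  obtain r where r: "(\<lambda>n. ln (real n) * r n) \<longlonglongrightarrow> 0"
    and lo_eq: "\<forall>\<^sub>F n in sequentially.
      lo n = (real n)\<^sup>2 / (4 * ln (real n)) * (1 + (ln (ln (real n)) + a) / ln (real n) + r n)"
    using critical_expansionD[OF lo] .
  obtain s where s: "(\<lambda>n. ln (real n) * s n) \<longlonglongrightarrow> 0"
    and hi_eq: "\<forall>\<^sub>F n in sequentially.
      hi n = (real n)\<^sup>2 / (4 * ln (real n)) * (1 + (ln (ln (real n)) + b) / ln (real n) + s n)"
    using critical_expansionD[OF hi] .
  have "(\<lambda>n. 1 + (ln (real n) * s n - ln (real n) * r n) / (b - a)) \<longlonglongrightarrow> 1 + (0 - 0) / (b - a)"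
    using \<open>a < b\<close> by (intro tendsto_intros r s) simp
  moreover have "\<forall>\<^sub>F n in sequentially. 1 + (ln (real n) * s n - ln (real n) * r n) / (b - a) =
      (hi n - lo n) / ((b - a) / 4 * (real n / ln (real n))\<^sup>2)"
    using lo_eq hi_eq eventually_gt_at_top[of 1]
  proof eventually_elim
    case (elim n)
    then have "0 < ln (real n)" by simp
    then show ?case
      using elim \<open>a < b\<close> by (simp add: elim(1,2)) (simp add: field_simps power2_eq_square)
  qed
  ultimately have ratio: "(\<lambda>n. (hi n - lo n) / ((b - a) / 4 * (real n / ln (real n))\<^sup>2)) \<longlonglongrightarrow> 1"
    by (simp add: tendsto_cong)
  show "(\<lambda>n. hi n - lo n) \<sim>[sequentially] (\<lambda>n. (b - a) / 4 * (real n / ln (real n))\<^sup>2)"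
    using ratio by (rule asymp_equivI'[rotated]) 
  \<comment> \<open>A ratio tending to 1 is eventually positive, and its denominator is nonnegative,
    so the endpoints are eventually in the right order.\<close>
  have "\<forall>\<^sub>F n in sequentially. 0 < (hi n - lo n) / ((b - a) / 4 * (real n / ln (real n))\<^sup>2)"
    by (rule order_tendstoD[OF ratio]) simp
  moreover have "0 \<le> (b - a) / 4 * (real n / ln (real n))\<^sup>2" for n
    using \<open>a < b\<close> by simp
  ultimately have less: "\<forall>\<^sub>F n in sequentially. lo n < hi n"
    by (auto elim!: eventually_mono simp: zero_less_divide_iff not_less[symmetric] simp del: not_less)
  \<comment> \<open>The largest integer strictly below \<open>lo n\<close>: the window is closed on
    the left, so a time equal to \<open>lo n\<close> must not be subtracted.\<close>
  let ?lo' = "\<lambda>n. real_of_int (\<lceil>lo n\<rceil> - 1)"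
  have lo': "critical_expansion a ?lo'"
    by (rule critical_expansion_shift[OF lo]) (intro always_eventually allI, linarith)
  have "(\<lambda>n. e n (hi n) - e n (?lo' n)) \<longlonglongrightarrow> exp (2 * b) / 8 - exp (2 * a) / 8"
    by (intro tendsto_diff e_tendsto hi lo')
  moreover have "\<forall>\<^sub>F n in sequentially. e n (hi n) - e n (?lo' n) =
      expected_detachments n {j. 1 \<le> j \<and> lo n \<le> real j \<and> real j \<le> hi n}"
    using less eventually_k_pos[OF lo]
  proof eventually_elim
    case (elim n)
    let ?J = "{j. 1 \<le> j \<and> lo n \<le> real j \<and> real j \<le> hi n}"
    have J: "?J = {1..nat \<lfloor>hi n\<rfloor>} - {1..nat \<lfloor>?lo' n\<rfloor>}"
      using elim by (auto; linarith)
    have "nat \<lfloor>?lo' n\<rfloor> \<le> nat \<lfloor>hi n\<rfloor>"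
      using elim by linarith
    then have "(\<Sum>j\<in>?J. detach_prob n j) = e n (hi n) - e n (?lo' n)"
      unfolding J e_eq_sum by (intro sum_diff) auto
    moreover have "expected_detachments n ?J = (\<Sum>j\<in>?J. detach_prob n j)"
      unfolding J by (intro expected_detachments_eq_sum) auto
    ultimately show ?case by simp
  qed
  ultimately show "(\<lambda>n. expected_detachments n {j. 1 \<le> j \<and> lo n \<le> real j \<and> real j \<le> hi n})
      \<longlonglongrightarrow> (exp (2 * b) - exp (2 * a)) / 8"
    by (simp add: tendsto_cong diff_divide_distrib)
qed

section \<open>Expansion of \<open>k_of_y\<close>\<close>

definition k_of_y_remainder :: "real \<Rightarrow> nat \<Rightarrow> real" where
  "k_of_y_remainder y n = ((ln (ln (real n)) - y / 2) / ln (real n))\<^sup>2 /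
     (1 - (ln (ln (real n)) - y / 2) / ln (real n))"

lemma k_of_y_remainder_bigo: "k_of_y_remainder y \<in> O(\<lambda>n. (ln (ln (real n)) / ln (real n))\<^sup>2)"
  unfolding k_of_y_remainder_def [abs_def] by real_asymp

text \<open>With \<open>d = (ln (ln n) - y / 2) / ln n\<close> the denominator is
  \<open>4 * ln n * (1 - d)\<close>. The geometric expansion
  \<open>1 / (1 - d) = 1 + d + d^2 / (1 - d)\<close> makes the remainder explicit; eventually
  \<open>d < 1\<close>, so the division is legitimate.\<close>

lemma k_of_y_eq:
  "\<forall>\<^sub>F n in sequentially. k_of_y y n = (real n)\<^sup>2 / (4 * ln (real n)) *
     (1 + (ln (ln (real n)) + - y / 2) / ln (real n) + k_of_y_remainder y n)"
proof -
  have "\<forall>\<^sub>F n in sequentially. (ln (ln (real n)) - y / 2) / ln (real n) < 1"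
    by real_asymp
  then show ?thesis
    using eventually_gt_at_top[of 1]
  proof eventually_elim
    case (elim n)
    define d where "d = (ln (ln (real n)) - y / 2) / ln (real n)"
    have pos: "0 < ln (real n)" using elim by simp
    have d: "d < 1" using elim by (simp add: d_def)
    have "2 * (2 * ln (real n) - 2 * ln (ln (real n)) + y) = 4 * ln (real n) * (1 - d)"
      using pos by (simp add: d_def field_simps)
    then have "k_of_y y n = (real n)\<^sup>2 / (4 * ln (real n)) * (1 / (1 - d))"
      by (simp add: k_of_y_def)
    also have "1 / (1 - d) = 1 + d + d\<^sup>2 / (1 - d)"
      using d by (simp add: field_simps power2_eq_square)
    finally show ?case
      by (simp add: d_def k_of_y_remainder_def)
  qed
qed

lemma critical_expansion_k_of_y: "critical_expansion (- y / 2) (k_of_y y)"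
  unfolding critical_expansion_def by (intro bexI[where x = "k_of_y_remainder y"] k_of_y_eq k_of_y_remainder_bigo)

text \<open>The subtracted terms are exactly the prefactor times \<open>1 + d\<close>. What is left
  is the prefactor times the remainder, which turns the relative error into the absolute
  one.\<close>

lemma k_of_y_bigo:
  "(\<lambda>n. k_of_y y n
      - ((real n)\<^sup>2 / (4 * ln (real n))
         + (real n)\<^sup>2 * ln (ln (real n)) / (4 * (ln (real n))\<^sup>2)
         - (real n)\<^sup>2 * y / (8 * (ln (real n))\<^sup>2)))
    \<in> O(\<lambda>n. (real n)\<^sup>2 * (ln (ln (real n)))\<^sup>2 / (ln (real n)) ^ 3)" (is "?f \<in> O(?g)")
proof -
  have "\<forall>\<^sub>F n in sequentially. ?f n = (real n)\<^sup>2 / (4 * ln (real n)) * k_of_y_remainder y n"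
    using k_of_y_eq[of y] eventually_gt_at_top[of 1]
  proof eventually_elim
    case (elim n)
    then have "0 < ln (real n)" by simp
    then have "(real n)\<^sup>2 / (4 * ln (real n)) * (1 + (ln (ln (real n)) + - y / 2) / ln (real n)) =
        (real n)\<^sup>2 / (4 * ln (real n)) + (real n)\<^sup>2 * ln (ln (real n)) / (4 * (ln (real n))\<^sup>2)
         - (real n)\<^sup>2 * y / (8 * (ln (real n))\<^sup>2)"
      by (simp add: field_simps power2_eq_square)
    with elim(1) show ?case by (simp only: distrib_left)
  qed
  moreover have "(\<lambda>n. (real n)\<^sup>2 / (4 * ln (real n)) * k_of_y_remainder y n) \<in>
      O(\<lambda>n. (real n)\<^sup>2 / (4 * ln (real n)) * (ln (ln (real n)) / ln (real n))\<^sup>2)"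
    by (intro landau_o.big.mult k_of_y_remainder_bigo) simp
  moreover have "(\<lambda>n. (real n)\<^sup>2 / (4 * ln (real n)) * (ln (ln (real n)) / ln (real n))\<^sup>2) \<in> O(?g)"
    by real_asymp
  ultimately show ?thesis
    using landau_o.big.in_cong[of ?f "\<lambda>n. (real n)\<^sup>2 / (4 * ln (real n)) * k_of_y_remainder y n"
        sequentially ?g] landau_o.big_trans by simp
qed

theorem corollary5p2:
  "(\<forall>y::real. y > 0 \<longrightarrow>
      (\<lambda>n. k_of_y y n
          - ((real n)\<^sup>2 / (4 * ln (real n))
             + (real n)\<^sup>2 * ln (ln (real n)) / (4 * (ln (real n))\<^sup>2)
             - (real n)\<^sup>2 * y / (8 * (ln (real n))\<^sup>2)))
        \<in> O(\<lambda>n. (real n)\<^sup>2 * (ln (ln (real n)))\<^sup>2 / (ln (real n)) ^ 3)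
      \<and> critical_expansion (- y / 2) (k_of_y y))
   \<and> (\<forall>(c::real) k. c > 1 / 8 \<longrightarrow> critical_expansion (ln (sqrt (8 * c))) k \<longrightarrow>
        (\<lambda>n. e n (k n)) \<longlonglongrightarrow> c)
   \<and> (\<forall>(const1::real) (const2::real) lo hi. 0 < const1 \<longrightarrow> const1 < const2 \<longrightarrow>
        critical_expansion const1 lo \<longrightarrow> critical_expansion const2 hi \<longrightarrow>
        (\<lambda>n. expected_detachments n {j. 1 \<le> j \<and> lo n \<le> real j \<and> real j \<le> hi n})
          \<longlonglongrightarrow> (exp (2 * const2) - exp (2 * const1)) / 8
        \<and> (\<lambda>n. hi n - lo n) \<sim>[sequentially]
            (\<lambda>n. (const2 - const1) / 4 * (real n / ln (real n))\<^sup>2))"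
proof (intro conjI allI impI)
  fix c :: real and k
  assume "c > 1 / 8" "critical_expansion (ln (sqrt (8 * c))) k"
  \<comment> \<open>The constant \<open>ln (sqrt (8 * c))\<close> is the solution \<open>a\<close>
    of \<open>exp (2 * a) / 8 = c\<close>.\<close>
  moreover from this have "exp (2 * ln (sqrt (8 * c))) = 8 * c"
    by (simp add: ln_sqrt)
  ultimately show "(\<lambda>n. e n (k n)) \<longlonglongrightarrow> c"
    using e_tendsto by fastforce
qed (rule k_of_y_bigo critical_expansion_k_of_y | (rule window_tendsto; assumption))+

end
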